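(* Let $\mathcal{C}_0$ be a self-orthogonal code over $I_5$ of length $n$ with generator matrix $G_0=(\mathbf{r}_i)$, where $\mathbf{r}_i$ is the $i$th row of $G_0$ for $i=1,2,\dots,m$. Let $\mathbf{x}\in\mathbb{F}_5^n$ and let $\mu,\nu\in J=\{0,\mathtt{b},2\mathtt{b},3\mathtt{b},4\mathtt{b}\}$, not both zero, such that $2\mu+\nu=0$. Then the code $\mathcal{C}$ over $I_5$ with generator matrix $$G=\left(\begin{array}{cc|c} 0 & \mu & \nu\mathbf{x}\\ \hline (\mathbf{x},\mathbf{r}_1) & 2(\mathbf{x},\mathbf{r}_1) & \mathbf{r}_1\\ \vdots&\vdots&\vdots\\ (\mathbf{x},\mathbf{r}_m) & 2(\mathbf{x},\mathbf{r}_m) & \mathbf{r}_m\end{array}\right)$$ is a self-orthogonal code of length $n+2$.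
   Context: $I_5$ is the commutative ring without unity of order 25 and characteristic 5 generated by $\mathtt{a},\mathtt{b}$ with relations $5\mathtt{a}=5\mathtt{b}=0$, $\mathtt{a}^2=\mathtt{b}$, $\mathtt{a}\mathtt{b}=0$ (hence $\mathtt{b}^2=0$); every element is uniquely $\mathtt{a}x+\mathtt{b}y$ with $x,y\in\mathbb{F}_5$. $J=\{j\mathtt{b}:0\le j<5\}$ is its maximal ideal. $\mathbb{F}_5$ acts naturally on $I_5$ by repeated addition. A linear code of length $n$ over $I_5$ is an $I_5$-submodule of $I_5^n$; the code with generator matrix $G$ is the smallest $I_5$-submodule (additive subgroup closed under multiplication by $I_5$) containing the rows of $G$. For $\mathbf{x}\in\mathbb{F}_5^n$, $\mathbf{r}\in I_5^n$, $(\mathbf{x},\mathbf{r})=\sum_i x_ir_i\in I_5$; for $\mathbf{y},\mathbf{z}\in I_5^n$, $(\mathbf{y},\mathbf{z})=\sum_i y_iz_i$. For $\nu\in I_5$ and $\mathbf{x}\in\mathbb{F}_5^n$, $\nu\mathbf{x}=(\nu x_1,\dots,\nu x_n)$. A code $\mathcal{C}$ is self-orthogonal if $(\mathbf{y},\mathbf{z})=0$ for all $\mathbf{y},\mathbf{z}\in\mathcal{C}$. *)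

theory Defs
  imports "Jordan_Normal_Form.Matrix" "HOL-Library.Numeral_Type"
begin

section \<open>The ring \<open>I\<^sub>5\<close>\<close>

text \<open>The field with five elements is the numeral type \<open>5\<close> (integers modulo five).
  \<open>I5 x y\<close> stands for \<open>a x + b y\<close>; by \<open>a\<^sup>2 = b\<close> and \<open>a b = b\<^sup>2 = 0\<close> the product of
  \<open>a x + b y\<close> and \<open>a x' + b y'\<close> is \<open>b (x x')\<close>.\<close>

datatype I5 = I5 (acoeff: 5) (bcoeff: 5)

instantiation I5 :: comm_ring
begin

definition zero_I5 :: I5 where "0 = I5 0 0"

definition plus_I5 :: "I5 \<Rightarrow> I5 \<Rightarrow> I5" where
  "r + s = I5 (acoeff r + acoeff s) (bcoeff r + bcoeff s)"

definition uminus_I5 :: "I5 \<Rightarrow> I5" where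
  "- r = I5 (- acoeff r) (- bcoeff r)"

definition minus_I5 :: "I5 \<Rightarrow> I5 \<Rightarrow> I5" where
  "r - s = I5 (acoeff r - acoeff s) (bcoeff r - bcoeff s)"

definition times_I5 :: "I5 \<Rightarrow> I5 \<Rightarrow> I5" where
  "r * s = I5 0 (acoeff r * acoeff s)"

instance
  by standard
    (simp_all add: zero_I5_def plus_I5_def uminus_I5_def minus_I5_def times_I5_def algebra_simps)

end

definition gen_a :: I5 where "gen_a = I5 1 0"

definition gen_b :: I5 where "gen_b = I5 0 1"

definition mult_nat :: "nat \<Rightarrow> I5 \<Rightarrow> I5" where
  "mult_nat k r = (((+) r) ^^ k) 0"

text \<open>The action of the field with five elements by repeated addition;
  \<open>Rep_bit1 t\<close> is the integer in \<open>{0..<5}\<close> representing \<open>t\<close>.\<close>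

definition F5_scale :: "5 \<Rightarrow> I5 \<Rightarrow> I5"  (infixr \<open>*\<^sub>F\<close> 75) where
  "t *\<^sub>F r = mult_nat (nat (Rep_bit1 t)) r"

definition J :: "I5 set" where
  "J = {mult_nat j gen_b | j. j < 5}"

lemma mult_nat_eq: "mult_nat k r = I5 (of_nat k * acoeff r) (of_nat k * bcoeff r)"
  unfolding mult_nat_def
  by (induction k) (simp_all add: zero_I5_def plus_I5_def algebra_simps)

lemma Rep_F5_bounds: "0 \<le> Rep_bit1 (t :: 5)" "Rep_bit1 (t :: 5) < 5"
  using Rep_bit1[of t] by simp_all

lemma of_nat_Rep_F5: "of_nat (nat (Rep_bit1 (t :: 5))) = t"
proof -
  have "of_nat (nat (Rep_bit1 t)) = (of_int (Rep_bit1 t) :: 5)"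
    using Rep_F5_bounds(1)[of t] by (simp only: of_nat_nat)
  also have "\<dots> = Abs_bit1 (Rep_bit1 t)"
    by (rule trans[OF bit1.of_int_eq]) (simp only: bit1.Rep_mod)
  also have "\<dots> = t"
    by (rule Rep_bit1_inverse)
  finally show ?thesis .
qed

lemma F5_scale_eq: "t *\<^sub>F r = I5 (t * acoeff r) (t * bcoeff r)"
  by (simp add: F5_scale_def mult_nat_eq of_nat_Rep_F5)

lemma F5_scale_of_nat: "of_nat k *\<^sub>F r = mult_nat k r"
  by (simp add: F5_scale_eq mult_nat_eq)

lemma I5_relations:
  "mult_nat 5 gen_a = 0" "mult_nat 5 gen_b = 0"
  "gen_a * gen_a = gen_b" "gen_a * gen_b = 0" "gen_b * gen_b = 0"
  by (simp_all add: mult_nat_eq gen_a_def gen_b_def zero_I5_def times_I5_def)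

lemma I5_unique_representation: "\<exists>!(x, y). r = x *\<^sub>F gen_a + y *\<^sub>F gen_b"
  by (cases r) (auto simp: F5_scale_eq gen_a_def gen_b_def plus_I5_def)

lemma card_I5: "CARD(I5) = 25"
proof -
  have "bij (\<lambda>p. I5 (fst p) (snd p))"
    by (rule bij_betwI[where g = "\<lambda>r. (acoeff r, bcoeff r)"]) auto
  then have "CARD(5 \<times> 5) = CARD(I5)"
    by (rule bij_betw_same_card)
  then show ?thesis by simp
qed

lemma I5_no_unity: "\<not> (\<exists>e :: I5. \<forall>r. e * r = r)"
proof
  assume "\<exists>e :: I5. \<forall>r. e * r = r"
  then obtain e :: I5 where "e * gen_a = gen_a" by blast
  then show False by (simp add: gen_a_def times_I5_def)
qed

lemma J_eq: "J = {r. acoeff r = 0}"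
proof (intro Set.set_eqI iffI)
  fix r assume "r \<in> {r. acoeff r = 0}"
  moreover have "nat (Rep_bit1 (bcoeff r)) < 5"
    using Rep_F5_bounds[of "bcoeff r"] by (simp only: nat_less_iff)
  ultimately have "r = mult_nat (nat (Rep_bit1 (bcoeff r))) gen_b \<and> nat (Rep_bit1 (bcoeff r)) < 5"
    by (cases r) (simp add: mult_nat_eq gen_b_def of_nat_Rep_F5)
  then show "r \<in> J" unfolding J_def by blast
qed (auto simp: J_def mult_nat_eq gen_b_def)

section \<open>Linear codes\<close>

definition linear_code :: "nat \<Rightarrow> I5 vec set \<Rightarrow> bool" where
  "linear_code n C \<longleftrightarrow>
     C \<subseteq> carrier_vec n \<and> 0\<^sub>v n \<in> C \<and>
     (\<forall>u\<in>C. \<forall>v\<in>C. u + v \<in> C) \<and> (\<forall>v\<in>C. - v \<in> C) \<and>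
     (\<forall>r. \<forall>v\<in>C. r \<cdot>\<^sub>v v \<in> C)"

text \<open>As \<open>I\<^sub>5\<close> has no unity, the span of the rows with coefficients in \<open>I\<^sub>5\<close> need not contain
  the rows; the generated code is the smallest submodule containing them.\<close>

definition generated_code :: "I5 mat \<Rightarrow> I5 vec set" where
  "generated_code G = \<Inter> {C. linear_code (dim_col G) C \<and> set (rows G) \<subseteq> C}"

definition self_orthogonal :: "I5 vec set \<Rightarrow> bool" where
  "self_orthogonal C \<longleftrightarrow> (\<forall>y\<in>C. \<forall>z\<in>C. y \<bullet> z = 0)"

definition F5_prod :: "5 vec \<Rightarrow> I5 vec \<Rightarrow> I5" where
  "F5_prod x r = (\<Sum>i<dim_vec r. (x $ i) *\<^sub>F (r $ i))"

definition ring_times_vec :: "I5 \<Rightarrow> 5 vec \<Rightarrow> I5 vec" where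
  "ring_times_vec \<nu> x = map_vec (\<lambda>t. t *\<^sub>F \<nu>) x"

definition extended_matrix :: "5 vec \<Rightarrow> I5 \<Rightarrow> I5 \<Rightarrow> I5 mat \<Rightarrow> I5 mat" where
  "extended_matrix x \<mu> \<nu> G\<^sub>0 =
     mat_of_rows (dim_col G\<^sub>0 + 2)
       ((vec_of_list [0, \<mu>] @\<^sub>v ring_times_vec \<nu> x) #
        map (\<lambda>r. vec_of_list [F5_prod x r, 2 *\<^sub>F F5_prod x r] @\<^sub>v r) (rows G\<^sub>0))"

lemma linear_code_generated_code:
  assumes "G \<in> carrier_mat m n"
  shows "linear_code n (generated_code G)" "set (rows G) \<subseteq> generated_code G"
proof -
  have "linear_code n (carrier_vec n)" "set (rows G) \<subseteq> carrier_vec n"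
    using assms by (auto simp: linear_code_def rows_def)
  then show "linear_code n (generated_code G)"
    using assms unfolding generated_code_def linear_code_def by auto
  show "set (rows G) \<subseteq> generated_code G"
    by (auto simp: generated_code_def)
qed

end

theory Submission imports Defs
begin

text \<open>Orthogonality passes from generators to the generated code because orthogonal complements are
  submodules, so only pairs of rows of \<open>G\<close> matter. The top row has entries in \<open>J\<close>, which annihilates
  \<open>I\<^sub>5\<close>, and two other rows have the product of the original rows because \<open>1 + 2\<^sup>2 = 0\<close> modulo five.\<close>

text \<open>The set \<open>S\<close> is arbitrary because the complement is taken twice: of the
  rows, and then of the whole generated code.\<close>

lemma linear_code_orthogonal:
  assumes "S \<subseteq> carrier_vec n"
  shows "linear_code n {v \<in> carrier_vec n. \<forall>w\<in>S. v \<bullet> w = 0}"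
  unfolding linear_code_def
proof (intro conjI ballI allI)
  have S: "w \<in> carrier_vec n" if "w \<in> S" for w
    using assms that by blast
  fix u v r
  assume "v \<in> {v \<in> carrier_vec n. \<forall>w\<in>S. v \<bullet> w = 0}"
  then have v: "v \<in> carrier_vec n" "\<And>w. w \<in> S \<Longrightarrow> v \<bullet> w = 0" by auto
  show "- v \<in> {v \<in> carrier_vec n. \<forall>w\<in>S. v \<bullet> w = 0}"
  proof (intro CollectI conjI ballI)
    fix w assume "w \<in> S"
    then show "- v \<bullet> w = 0"
      using v(1) v(2)[of w] S[of w] scalar_prod_uminus_left[of v w] by (simp only: carrier_vecD) simp
  qed (use v(1) in simp)
  show "r \<cdot>\<^sub>v v \<in> {v \<in> carrier_vec n. \<forall>w\<in>S. v \<bullet> w = 0}"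
    using v S by auto
  assume "u \<in> {v \<in> carrier_vec n. \<forall>w\<in>S. v \<bullet> w = 0}"
  then show "u + v \<in> {v \<in> carrier_vec n. \<forall>w\<in>S. v \<bullet> w = 0}"
    using v S by (auto simp: add_scalar_prod_distrib)
qed (use assms in auto)

lemma generated_code_least:
  assumes "linear_code (dim_col G) C" and "set (rows G) \<subseteq> C"
  shows "generated_code G \<subseteq> C"
  using assms by (auto simp: generated_code_def)

lemma self_orthogonal_generated_code:
  assumes orth: "\<And>u v. u \<in> set (rows G) \<Longrightarrow> v \<in> set (rows G) \<Longrightarrow> u \<bullet> v = 0"
  shows "self_orthogonal (generated_code G)"
proof -
  define n where "n = dim_col G"
  have rows: "set (rows G) \<subseteq> carrier_vec n"
    by (auto simp: rows_def n_def)
  have gen: "generated_code G \<subseteq> carrier_vec n"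
    using linear_code_generated_code(1)[of G "dim_row G" n]
    by (auto simp: linear_code_def n_def)
  \<comment> \<open>First pass: pairwise orthogonal rows lie in the complement of the rows, and
    minimality of the generated code puts all of it there.\<close>
  have *: "generated_code G \<subseteq> {v \<in> carrier_vec n. \<forall>w\<in>set (rows G). v \<bullet> w = 0}"
    by (rule generated_code_least) (use linear_code_orthogonal[OF rows] rows orth in \<open>auto simp flip: n_def\<close>)
  have "u \<bullet> v = 0" if "u \<in> set (rows G)" "v \<in> generated_code G" for u v
    using * that rows comm_scalar_prod[of u n v] by fastforce
  \<comment> \<open>Second pass: with the factors swapped by commutativity, the rows lie in the
    complement of the whole code, so by minimality the code does too.\<close>
  then have "generated_code G \<subseteq> {v \<in> carrier_vec n. \<forall>w\<in>generated_code G. v \<bullet> w = 0}"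
    by (intro generated_code_least) (use linear_code_orthogonal[OF gen] rows in \<open>auto simp flip: n_def\<close>)
  then show ?thesis
    by (auto simp: self_orthogonal_def)
qed

text \<open>A product in \<open>I5\<close> depends only on the \<open>a\<close>-coefficients, and
  these vanish on \<open>J\<close>.\<close>

lemma J_times:
  assumes "r \<in> J"
  shows "r * s = 0" "s * r = 0"
  using assms by (simp_all add: J_eq times_I5_def zero_I5_def)

text \<open>Each summand vanishes by \<open>J_times\<close>. The sum in \<open>v \<bullet> w\<close>
  runs over the indices of its right factor, whence the bound \<open>dim_vec w\<close>.\<close>

lemma scalar_prod_J:
  assumes "\<And>i. i < dim_vec w \<Longrightarrow> v $ i \<in> J"
  shows "v \<bullet> w = 0"
  using assms by (auto simp: scalar_prod_def J_times intro!: sum.neutral)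

lemma F5_scale_J: "r \<in> J \<Longrightarrow> t *\<^sub>F r \<in> J"
  by (simp add: J_eq F5_scale_eq)

lemma extended_rows_scalar_prod:
  assumes "r \<in> carrier_vec n" and "r' \<in> carrier_vec n"
  shows "(vec_of_list [s, 2 *\<^sub>F s] @\<^sub>v r) \<bullet> (vec_of_list [s', 2 *\<^sub>F s'] @\<^sub>v r') = r \<bullet> r'"
proof -
  \<comment> \<open>With \<open>x\<close> and \<open>y\<close> the \<open>a\<close>-coefficients of
    \<open>s\<close> and \<open>s'\<close>, this is the \<open>b\<close>-coefficient contributed by
    the two prefixed coordinates.\<close>
  have five: "x * y + 2 * x * (2 * y) = 0" for x y :: 5
  proof -
    have "x * y + 2 * x * (2 * y) = 5 * (x * y)" by (simp add: algebra_simps)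
    also have "(5 :: 5) = 0" by simp
    finally show ?thesis by simp
  qed
  have "vec_of_list [s, 2 *\<^sub>F s] \<bullet> vec_of_list [s', 2 *\<^sub>F s'] = 0"
    using five by (simp add: scalar_prod_def F5_scale_eq times_I5_def plus_I5_def zero_I5_def)
  moreover have "vec_of_list [p, q] \<in> carrier_vec 2" for p q :: I5
    by (rule carrier_vecI) simp
  ultimately show ?thesis
    by (subst scalar_prod_append[OF _ assms(1) _ assms(2)]) auto
qed

theorem theorem3p2:
  fixes C\<^sub>0 C :: "I5 vec set" and G\<^sub>0 G :: "I5 mat" and x :: "5 vec"
    and \<mu> \<nu> :: I5 and m n :: nat
  assumes "G\<^sub>0 \<in> carrier_mat m n"
    and "C\<^sub>0 = generated_code G\<^sub>0"
    and "linear_code n C\<^sub>0" and "self_orthogonal C\<^sub>0"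
    and "x \<in> carrier_vec n"
    and "\<mu> \<in> J" and "\<nu> \<in> J" and "\<not> (\<mu> = 0 \<and> \<nu> = 0)"
    and "2 *\<^sub>F \<mu> + \<nu> = 0"
    and "G = extended_matrix x \<mu> \<nu> G\<^sub>0"
    and "C = generated_code G"
  shows "linear_code (n + 2) C \<and> self_orthogonal C"
proof
  define top where "top = vec_of_list [0, \<mu>] @\<^sub>v ring_times_vec \<nu> x"
  define ext where "ext r = vec_of_list [F5_prod x r, 2 *\<^sub>F F5_prod x r] @\<^sub>v r" for r
  have n: "dim_col G\<^sub>0 = n"
    using assms(1) by simp
  have G: "G = mat_of_rows (n + 2) (top # map ext (rows G\<^sub>0))"
    using assms(10) n by (simp only: extended_matrix_def top_def ext_def[abs_def])
  have rows0: "set (rows G\<^sub>0) \<subseteq> carrier_vec n"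
    using n by (auto simp: rows_def)
  have top_carrier: "top \<in> carrier_vec (n + 2)"
    using assms(5) by (intro carrier_vecI) (simp add: top_def ring_times_vec_def)
  have ext_carrier: "ext r \<in> carrier_vec (n + 2)" if "r \<in> carrier_vec n" for r
    using that by (intro carrier_vecI) (simp add: ext_def)
  \<comment> \<open>\<open>mat_of_rows\<close> returns its list as rows only when every vector in it
    has length \<open>n + 2\<close>.\<close>
  have rows: "set (rows G) = insert top (ext ` set (rows G\<^sub>0))"
    unfolding G using top_carrier ext_carrier rows0 by (subst rows_mat_of_rows) auto
  show "linear_code (n + 2) C"
    unfolding assms(11) G by (rule linear_code_generated_code(1)[OF mat_of_rows_carrier(1)])
  have top_J: "top $ i \<in> J" if "i < n + 2" for i
  proof -
    \<comment> \<open>The entries at 0 and 1 are \<open>0\<close> and \<open>\<mu>\<close>; the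
      entry at \<open>Suc (Suc k)\<close> is a multiple of \<open>\<nu>\<close>.\<close>
    consider "i = 0" | "i = 1" | k where "i = Suc (Suc k)"
      by (metis One_nat_def not0_implies_Suc)
    then show ?thesis
      using that assms(5-7)
      by cases (auto simp: top_def ring_times_vec_def F5_scale_J J_eq zero_I5_def F5_scale_eq)
  qed
  \<comment> \<open>Letting \<open>v\<close> be \<open>top\<close> or an extended row settles every
    pair that involves the top row, in either order.\<close>
  have top_orth: "top \<bullet> v = 0" "v \<bullet> top = 0" if "v \<in> carrier_vec (n + 2)" for v
    using scalar_prod_J[of v top] top_J that comm_scalar_prod[OF that top_carrier] by auto
  have ext_orth: "ext r \<bullet> ext r' = 0" if "r \<in> set (rows G\<^sub>0)" "r' \<in> set (rows G\<^sub>0)" for r r'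
  proof -
    have "ext r \<bullet> ext r' = r \<bullet> r'"
      unfolding ext_def using that rows0 by (intro extended_rows_scalar_prod) auto
    \<comment> \<open>The rows of \<open>G\<^sub>0\<close> lie in the self-orthogonal code
      \<open>C\<^sub>0\<close>.\<close>
    also have "\<dots> = 0"
      using that linear_code_generated_code(2)[OF assms(1)] assms(2,4)
      by (auto simp: self_orthogonal_def)
    finally show ?thesis .
  qed
  show "self_orthogonal C"
    unfolding assms(11)
  proof (rule self_orthogonal_generated_code)
    fix u v assume "u \<in> set (rows G)" "v \<in> set (rows G)"
    then show "u \<bullet> v = 0"
      unfolding rows using top_orth top_carrier ext_orth ext_carrier rows0 by blast
  qed
qed

end
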